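(* Let $X$ be a sequentially complete Hausdorff locally convex space over $\mathbb{C}$ and let $D=\sum_n a_n \frac{1}{n^s}$ be a Dirichlet series with coefficients $a_n\in X$. If $s(0)\in\mathbb{C}$ is such that the series $\sum_n x'(a_n)\frac{1}{n^{s(0)}}$ converges for every $x'\in X'$, then $\sum_n a_n\frac{1}{n^s}$ converges in $X$ for each $s\in\mathbb{C}$ with $\operatorname{Re} s>\operatorname{Re} s(0)$. In particular, $\sigma_c^w(D):=\sup_{x'\in X'}\sigma_c(x'(D))=\sigma_c(D)$.
   Context: $X'$ denotes the topological dual of $X$. For a Dirichlet series $D=\sum_n a_n\frac1{n^s}$ with coefficients in $X$ (variable $s\in\mathbb{C}$), the abscissa of convergence is $\sigma_c(D):=\inf\{r\in\mathbb{R} : \sum_n a_n\frac1{n^s}\text{ converges in }X\text{ for all } s \text{ with } \operatorname{Re}s>r\}$, the infimum being taken in the extended real line (so $\sigma_c(D)=+\infty$ if the series is nowhere convergent). For $x'\in X'$, $x'(D)$ denotes the scalar Dirichlet series $\sum_n x'(a_n)\frac1{n^s}$, and $\sigma_c(x'(D))$ is its abscissa of convergence (same definition with $X=\mathbb{C}$). *)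

theory Defs
  imports "HOL-Analysis.Analysis"
begin

text \<open>
  The library has no complex topological vector spaces, so the complex scalar multiplication is an
  explicit parameter, as in \<^locale>\<open>vector_space\<close>.  The space is the whole type, which carries
  the topology.
\<close>

locale locally_convex_space =
  vector_space smul
  for smul :: "complex \<Rightarrow> 'a::{topological_ab_group_add,t2_space} \<Rightarrow> 'a" +
  assumes continuous_scale: "continuous_on UNIV (\<lambda>(c, x). smul c x)"
    and locally_convex:
      "open U \<Longrightarrow> 0 \<in> U \<Longrightarrow>
        \<exists>V W. open W \<and> 0 \<in> W \<and> W \<subseteq> V \<and> V \<subseteq> U \<and>
          (\<forall>x\<in>V. \<forall>y\<in>V. \<forall>t\<in>{0..1::real}. smul (of_real (1 - t)) x + smul (of_real t) y \<in> V)"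

text \<open>
  In \<^class>\<open>uniform_topological_group_add\<close> addition is uniformly continuous, which forces the
  uniformity to be the translation-invariant one determined by the topology.  Hence every
  topological vector space carries exactly one such structure, and \<^const>\<open>Cauchy\<close> has
  its usual meaning:
\<close>

lemma Cauchy_iff_diff_in_neighbourhoods:
  fixes u :: "nat \<Rightarrow> 'a::uniform_topological_group_add"
  shows "Cauchy u \<longleftrightarrow>
    (\<forall>U. open U \<longrightarrow> 0 \<in> U \<longrightarrow> (\<exists>N. \<forall>n\<ge>N. \<forall>m\<ge>N. u n - u m \<in> U))"
proof (intro iffI allI impI)
  fix U :: "'a set"
  assume "Cauchy u" "open U" "0 \<in> U"
  then have ev: "eventually (\<lambda>(x, y). x = 0 \<longrightarrow> y \<in> U) uniformity"
    using eventually_nhds_uniformity[of "\<lambda>y. y \<in> U" 0] eventually_nhds_in_open by blast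
  obtain Q where Q: "eventually Q uniformity"
    "\<And>a b c. Q (a, b) \<Longrightarrow> (case (a - c, b - c) of (x, y) \<Rightarrow> x = 0 \<longrightarrow> y \<in> U)"
    using uniformity_of_uniform_continuous_invariant[OF uniformly_continuous_minus' ev] by metis
  obtain N where N: "\<forall>n\<ge>N. \<forall>m\<ge>N. Q (u n, u m)"
    using \<open>Cauchy u\<close> Q(1) unfolding Cauchy_uniform_iff by blast
  have "u n - u m \<in> U" if "n \<ge> N" "m \<ge> N" for n m
    using Q(2)[of "u m" "u n" "u m"] N that by auto
  then show "\<exists>N. \<forall>n\<ge>N. \<forall>m\<ge>N. u n - u m \<in> U" by blast
next
  assume *: "\<forall>U. open U \<longrightarrow> 0 \<in> U \<longrightarrow> (\<exists>N. \<forall>n\<ge>N. \<forall>m\<ge>N. u n - u m \<in> U)"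
  show "Cauchy u"
    unfolding Cauchy_uniform_iff
  proof (intro allI impI)
    fix P :: "'a \<times> 'a \<Rightarrow> bool"
    assume P: "eventually P uniformity"
    obtain Q where Q: "eventually Q uniformity"
      "\<And>a b c. Q (a, b) \<Longrightarrow> P (a + c, b + c)"
      using uniformity_of_uniform_continuous_invariant[OF uniformly_continuous_add' P] by metis
    have "eventually (\<lambda>(x, y). x = 0 \<longrightarrow> Q (0, y)) uniformity"
      using Q(1) by (rule eventually_mono) auto
    then obtain U where U: "open U" "0 \<in> U" "\<forall>y\<in>U. Q (0, y)"
      using eventually_nhds_uniformity[of "\<lambda>y. Q (0, y)" 0] unfolding eventually_nhds by blast
    with * obtain N where N: "\<forall>n\<ge>N. \<forall>m\<ge>N. u n - u m \<in> U" by blast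
    have "P (u n, u m)" if "n \<ge> N" "m \<ge> N" for n m
      using Q(2)[of 0 "u m - u n" "u n"] U(3) N that by auto
    then show "\<exists>N. \<forall>n\<ge>N. \<forall>m\<ge>N. P (u n, u m)" by blast
  qed
qed

locale sequentially_complete_lcs =
  locally_convex_space smul
  for smul :: "complex \<Rightarrow>
      'a::{uniform_topological_group_add,topological_ab_group_add,t2_space} \<Rightarrow> 'a" +
  assumes sequentially_complete: "Cauchy u \<Longrightarrow> convergent (u :: nat \<Rightarrow> 'a)"

definition topological_dual ::
  "(complex \<Rightarrow> 'a::{topological_space,ab_group_add} \<Rightarrow> 'a) \<Rightarrow> ('a \<Rightarrow> complex) set" where
  "topological_dual smul =
    {x'. Vector_Spaces.linear smul (*) x' \<and> continuous_on UNIV x'}"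

text \<open>
  Dirichlet series start at \<open>n = 1\<close>, so the value \<open>a 0\<close> is never used.  Taking \<open>smul\<close> to be
  multiplication on \<^typ>\<open>complex\<close> gives the scalar case.
\<close>

definition dirichlet_converges ::
  "(complex \<Rightarrow> 'a \<Rightarrow> 'a::{topological_space,comm_monoid_add}) \<Rightarrow> (nat \<Rightarrow> 'a) \<Rightarrow> complex \<Rightarrow> bool" where
  "dirichlet_converges smul a s \<longleftrightarrow>
    summable (\<lambda>n. smul (1 / of_nat (Suc n) powr s) (a (Suc n)))"

definition abscissa_conv ::
  "(complex \<Rightarrow> 'a \<Rightarrow> 'a::{topological_space,comm_monoid_add}) \<Rightarrow> (nat \<Rightarrow> 'a) \<Rightarrow> ereal" where
  "abscissa_conv smul a =
    Inf {ereal r | r. \<forall>s. Re s > r \<longrightarrow> dirichlet_converges smul a s}"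

definition weak_abscissa_conv ::
  "(complex \<Rightarrow> 'a::{topological_space,ab_group_add} \<Rightarrow> 'a) \<Rightarrow> (nat \<Rightarrow> 'a) \<Rightarrow> ereal" where
  "weak_abscissa_conv smul a =
    (SUP x'\<in>topological_dual smul. abscissa_conv (*) (\<lambda>n. x' (a n)))"

end

theory Submission
  imports Defs
begin

text \<open>
  Twist the coefficients by \<open>n powr - s0\<close>: their partial sums are then weakly convergent, hence
  weakly bounded, hence bounded for every continuous seminorm \<open>p\<close>.  Since \<open>n powr - (s - s0)\<close> tends to
  \<open>0\<close> and has bounded variation for \<open>Re s > Re s0\<close>, summation by parts shows that the partial sums of
  the original series at \<open>s\<close> are Cauchy.  Weakly bounded sequences are bounded by a gliding hump
  argument among the functionals dominated by \<open>p\<close>, which needs only that \<open>p\<close> is normed by such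
  functionals.  These come from the Hahn--Banach theorem, proved here by showing that the minimal
  sublinear functionals are the linear ones.
\<close>

section \<open>Hahn--Banach by minimal sublinear functionals\<close>

definition sublinear :: "(real \<Rightarrow> 'b::ab_group_add \<Rightarrow> 'b) \<Rightarrow> ('b \<Rightarrow> real) \<Rightarrow> bool" where
  "sublinear sc q \<longleftrightarrow>
    (\<forall>x y. q (x + y) \<le> q x + q y) \<and> (\<forall>t x. 0 \<le> t \<longrightarrow> q (sc t x) = t * q x)"

locale real_vector_space = vector_space sc
  for sc :: "real \<Rightarrow> 'b::ab_group_add \<Rightarrow> 'b"
begin

lemma sublinearD:
  assumes "sublinear sc q"
  shows sublinear_add: "q (x + y) \<le> q x + q y"
    and sublinear_scale: "0 \<le> t \<Longrightarrow> q (sc t x) = t * q x"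
    and sublinear_zero: "q 0 = 0"
    and sublinear_lower: "- q (- x) \<le> q x"
proof -
  show add: "q (x + y) \<le> q x + q y" for x y
    using assms unfolding sublinear_def by blast
  show "0 \<le> t \<Longrightarrow> q (sc t x) = t * q x"
    using assms unfolding sublinear_def by blast
  have "q (sc 0 0) = 0 * q 0"
    using assms unfolding sublinear_def by blast
  then show zero: "q 0 = 0" by simp
  show "- q (- x) \<le> q x"
    using add[of x "- x"] zero by simp
qed

text \<open>For positive \<open>t\<close> one inequality suffices: applied to \<open>1 / t\<close>
  and \<open>sc t x\<close> it yields the other.\<close>

lemma sublinearI:
  assumes add: "\<And>x y. q (x + y) \<le> q x + q y" and zero: "q 0 = 0"
    and scale: "\<And>t x. 0 < t \<Longrightarrow> q (sc t x) \<le> t * q x"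
  shows "sublinear sc q"
  unfolding sublinear_def
proof (intro conjI allI impI add)
  fix t :: real and x assume "0 \<le> t"
  show "q (sc t x) = t * q x"
  proof (cases "t = 0")
    case False
    with \<open>0 \<le> t\<close> have "0 < t" by simp
    have "t * q (sc (1 / t) (sc t x)) \<le> t * (1 / t * q (sc t x))"
      using \<open>0 < t\<close> by (intro mult_left_mono scale) auto
    then have "t * q x \<le> q (sc t x)"
      using \<open>0 < t\<close> by simp
    with scale[OF \<open>0 < t\<close>, of x] show ?thesis by simp
  qed (simp add: zero)
qed

text \<open>
  The largest sublinear functional below \<open>p\<close> among those that are at most \<open>- p y\<close> at \<open>- y\<close>.
\<close>

definition descent :: "('b \<Rightarrow> real) \<Rightarrow> 'b \<Rightarrow> 'b \<Rightarrow> real" where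
  "descent p y x = (INF t\<in>{0..}. p (x + sc t y) - t * p y)"

context
  fixes p :: "'b \<Rightarrow> real"
  assumes p: "sublinear sc p"
begin

text \<open>Keeps the infimum in \<open>descent\<close> finite: \<open>t * p y = p (sc t y)\<close>,
  and \<open>sc t y\<close> is the sum of \<open>x + sc t y\<close> and \<open>- x\<close>.\<close>

lemma descent_bound:
  assumes "0 \<le> t"
  shows "- p (- x) \<le> p (x + sc t y) - t * p y"
  using sublinear_add[OF p, of "x + sc t y" "- x"] sublinear_scale[OF p assms, of y] by simp

lemma descent_le: "0 \<le> t \<Longrightarrow> descent p y x \<le> p (x + sc t y) - t * p y"
  unfolding descent_def by (intro cINF_lower bdd_belowI2[where m = "- p (- x)"] descent_bound) auto

lemma descent_greatest:
  "(\<And>t. 0 \<le> t \<Longrightarrow> m \<le> p (x + sc t y) - t * p y) \<Longrightarrow> m \<le> descent p y x"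
  unfolding descent_def by (intro cINF_greatest) auto

lemma descent_le_self: "descent p y x \<le> p x"
  using descent_le[of 0 y x] by simp

lemma sublinear_descent: "sublinear sc (descent p y)"
proof (rule sublinearI)
  fix x z
  \<comment> \<open>One infimum is moved to the left so that \<open>descent_greatest\<close> can
    treat the two one after the other; their parameters combine to \<open>s + t\<close>.\<close>
  have "descent p y (x + z) - descent p y x \<le> descent p y z"
  proof (rule descent_greatest)
    fix t :: real assume t: "0 \<le> t"
    have "descent p y (x + z) - (p (z + sc t y) - t * p y) \<le> descent p y x"
    proof (rule descent_greatest)
      fix s :: real assume s: "0 \<le> s"
      have "descent p y (x + z) \<le> p (x + z + sc (s + t) y) - (s + t) * p y"
        using s t by (intro descent_le) simp
      also have "x + z + sc (s + t) y = (x + sc s y) + (z + sc t y)"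
        by (simp add: scale_left_distrib algebra_simps)
      also have "p \<dots> \<le> p (x + sc s y) + p (z + sc t y)"
        by (rule sublinear_add[OF p])
      finally show "descent p y (x + z) - (p (z + sc t y) - t * p y) \<le> p (x + sc s y) - s * p y"
        by (simp add: algebra_simps)
    qed
    then show "descent p y (x + z) - descent p y x \<le> p (z + sc t y) - t * p y"
      by simp
  qed
  then show "descent p y (x + z) \<le> descent p y x + descent p y z" by simp
next
  show "descent p y 0 = 0"
  proof (rule antisym)
    show "descent p y 0 \<le> 0"
      using descent_le_self[of y 0] sublinear_zero[OF p] by simp
    show "0 \<le> descent p y 0"
      by (rule descent_greatest) (simp add: sublinear_scale[OF p])
  qed
next
  fix c :: real and x assume c: "0 < c"
  have "descent p y (sc c x) / c \<le> descent p y x"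
  proof (rule descent_greatest)
    fix t :: real assume t: "0 \<le> t"
    have "descent p y (sc c x) \<le> p (sc c x + sc (c * t) y) - c * t * p y"
      using c t by (intro descent_le) simp
    also have "sc c x + sc (c * t) y = sc c (x + sc t y)"
      by (simp add: scale_right_distrib)
    also have "p \<dots> = c * p (x + sc t y)"
      using c by (intro sublinear_scale[OF p]) simp
    finally show "descent p y (sc c x) / c \<le> p (x + sc t y) - t * p y"
      using c by (simp add: field_simps)
  qed
  then show "descent p y (sc c x) \<le> c * descent p y x"
    using c by (simp add: field_simps)
qed

text \<open>Minimality forces \<open>descent p y = p\<close>; the parameter \<open>t = 1\<close> in
  the infimum then gives \<open>p x + p y \<le> p (x + y)\<close>. Additivity settles the negative
  scalars.\<close>

lemma minimal_sublinear_linear: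
  assumes minimal: "\<And>q. sublinear sc q \<Longrightarrow> q \<le> p \<Longrightarrow> q = p"
  shows "Vector_Spaces.linear sc (*) p"
proof -
  have descent: "descent p y = p" for y
    by (intro minimal sublinear_descent le_funI descent_le_self)
  have add: "p (x + y) = p x + p y" for x y
    using descent_le[of 1 y x] descent sublinear_add[OF p, of x y] by simp
  have neg: "p (- x) = - p x" for x
    using add[of x "- x"] sublinear_zero[OF p] by simp
  have "p (sc t x) = t * p x" for t x
  proof (cases "0 \<le> t")
    case False
    then have "p (sc (- t) x) = - t * p x"
      by (intro sublinear_scale[OF p]) simp
    then show ?thesis by (simp add: neg)
  qed (rule sublinear_scale[OF p])
  then show ?thesis
    by (intro Vector_Spaces.linear_iff[THEN iffD2] conjI allI vector_space_axioms add)
       (unfold_locales, simp_all add: algebra_simps)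
qed

text \<open>The pointwise infimum works: \<open>- p (- x)\<close> bounds it from below, and for
  subadditivity two members of the chain are replaced by the smaller one.\<close>

lemma sublinear_chain_Inf:
  assumes "C \<noteq> {}" and C: "\<And>f. f \<in> C \<Longrightarrow> sublinear sc f \<and> f \<le> p"
    and chain: "\<And>f g. f \<in> C \<Longrightarrow> g \<in> C \<Longrightarrow> f \<le> g \<or> g \<le> f"
  shows "\<exists>q. sublinear sc q \<and> (\<forall>f\<in>C. q \<le> f)"
proof -
  define q where "q x = (INF f\<in>C. f x)" for x
  have bdd: "bdd_below ((\<lambda>f. f x) ` C)" for x
  proof (rule bdd_belowI2)
    fix f assume "f \<in> C"
    then show "- p (- x) \<le> f x"
      using C[of f] sublinear_lower[of f x] le_funD[of f p "- x"] by force
  qed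
  have lower: "q x \<le> f x" if "f \<in> C" for f x
    unfolding q_def by (rule cINF_lower[OF bdd that])
  have greatest: "m \<le> q x" if "\<And>f. f \<in> C \<Longrightarrow> m \<le> f x" for m x
    unfolding q_def using \<open>C \<noteq> {}\<close> that by (rule cINF_greatest)
  have "sublinear sc q"
  proof (rule sublinearI)
    fix x y
    have "q (x + y) - q x \<le> q y"
    proof (rule greatest)
      fix g assume g: "g \<in> C"
      have "q (x + y) - g y \<le> q x"
      proof (rule greatest)
        fix f assume f: "f \<in> C"
        obtain h where h: "h \<in> C" "h \<le> f" "h \<le> g"
          using chain[OF f g] f g by blast
        then have "h (x + y) \<le> f x + g y"
          using sublinear_add[of h x y] C[of h] le_funD[of h f x] le_funD[of h g y] by force
        with lower[OF h(1), of "x + y"] show "q (x + y) - g y \<le> f x" by simp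
      qed
      then show "q (x + y) - q x \<le> g y" by simp
    qed
    then show "q (x + y) \<le> q x + q y" by simp
  next
    have zero: "f 0 = 0" if "f \<in> C" for f
      using C[OF that] sublinear_zero by blast
    show "q 0 = 0"
    proof (rule antisym)
      obtain f where "f \<in> C" using \<open>C \<noteq> {}\<close> by blast
      then show "q 0 \<le> 0" using lower[of f 0] zero[of f] by simp
      show "0 \<le> q 0" by (rule greatest) (simp add: zero)
    qed
  next
    fix t :: real and x assume t: "0 < t"
    have "q (sc t x) / t \<le> q x"
    proof (rule greatest)
      fix f assume f: "f \<in> C"
      then show "q (sc t x) / t \<le> f x"
        using lower[OF f, of "sc t x"] sublinear_scale[of f t x] C[OF f] t
        by (simp add: field_simps)
    qed
    then show "q (sc t x) \<le> t * q x"
      using t by (simp add: field_simps)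
  qed
  with lower show ?thesis by (intro exI[of _ q]) (auto intro: le_funI)
qed

text \<open>Zorn's lemma for the reversed pointwise order yields a minimal sublinear functional
  below \<open>p\<close>.\<close>

lemma dominated_linear_exists: "\<exists>f. Vector_Spaces.linear sc (*) f \<and> f \<le> p"
proof -
  define A where "A = {q. sublinear sc q \<and> q \<le> p}"
  have "\<exists>m\<in>A. \<forall>q\<in>A. q \<le> m \<longrightarrow> q = m"
  proof (rule predicate_Zorn)
    show "partial_order_on A (relation_of (\<lambda>f g. g \<le> f) A)"
      by (rule partial_order_on_relation_ofI) auto
    fix C assume "C \<in> Chains (relation_of (\<lambda>f g. g \<le> f) A)"
    then have C: "f \<in> A \<and> g \<in> A \<and> (f \<le> g \<or> g \<le> f)" if "f \<in> C" "g \<in> C" for f g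
      using that unfolding Chains_def relation_of_def by blast
    show "\<exists>u\<in>A. \<forall>a\<in>C. u \<le> a"
    proof (cases "C = {}")
      case True
      then show ?thesis using p by (intro bexI[of _ p]) (auto simp: A_def)
    next
      case False
      obtain q where "sublinear sc q" "\<forall>f\<in>C. q \<le> f"
        using sublinear_chain_Inf[OF False] C unfolding A_def by blast
      moreover obtain f where "f \<in> C" using False by blast
      ultimately show ?thesis
        using C[of f f] by (intro bexI[of _ q]) (auto simp: A_def intro: order_trans)
    qed
  qed
  then obtain m where m: "m \<in> A" "\<And>q. q \<in> A \<Longrightarrow> q \<le> m \<Longrightarrow> q = m"
    by blast
  \<comment> \<open>The minimality criterion is applied to \<open>m\<close> in place of the fixed
    \<open>p\<close>. Minimality within \<open>A\<close> suffices, since whatever lies below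
    \<open>m\<close> lies below \<open>p\<close>.\<close>
  have "Vector_Spaces.linear sc (*) m"
  proof (rule real_vector_space.minimal_sublinear_linear[OF real_vector_space_axioms])
    show "sublinear sc m" using m(1) by (simp add: A_def)
    show "q = m" if "sublinear sc q" "q \<le> m" for q
      using m that by (auto simp: A_def intro: order_trans)
  qed
  with m(1) show ?thesis by (auto simp: A_def)
qed

end

text \<open>A linear functional below \<open>descent p y\<close> is at most \<open>- p y\<close> at
  \<open>- y\<close>, hence at least \<open>p y\<close> at \<open>y\<close>.\<close>

lemma norming_linear_exists:
  assumes p: "sublinear sc p"
  shows "\<exists>f. Vector_Spaces.linear sc (*) f \<and> f \<le> p \<and> f y = p y"
proof -
  obtain f where f: "Vector_Spaces.linear sc (*) f" "f \<le> descent p y"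
    using dominated_linear_exists[OF sublinear_descent[OF p]] by blast
  interpret f: Vector_Spaces.linear sc "(*)" f by (rule f(1))
  have le: "f \<le> p"
    using f(2) descent_le_self[OF p] by (auto simp: le_fun_def intro: order_trans)
  have "f (- y) \<le> p (- y + sc 1 y) - 1 * p y"
    using le_funD[OF f(2), of "- y"] descent_le[OF p, of 1 y "- y"] by simp
  then have "p y \<le> f y"
    by (simp add: f.neg sublinear_zero[OF p])
  with f(1) le show ?thesis by (auto simp: le_fun_def intro!: antisym)
qed

end

section \<open>Seminorms and uniform boundedness\<close>

definition seminorm :: "(complex \<Rightarrow> 'b::ab_group_add \<Rightarrow> 'b) \<Rightarrow> ('b \<Rightarrow> real) \<Rightarrow> bool" where
  "seminorm smul p \<longleftrightarrow>
    (\<forall>x y. p (x + y) \<le> p x + p y) \<and> (\<forall>c x. p (smul c x) = norm c * p x)"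

locale complex_vector_space = vector_space smul
  for smul :: "complex \<Rightarrow> 'b::ab_group_add \<Rightarrow> 'b"
begin

lemma real_vector_space: "real_vector_space (\<lambda>t. smul (of_real t))"
  by unfold_locales (simp_all add: scale_right_distrib scale_left_distrib)

lemma seminormD:
  assumes "seminorm smul p"
  shows seminorm_add: "p (x + y) \<le> p x + p y"
    and seminorm_scale: "p (smul c x) = norm c * p x"
    and seminorm_zero: "p 0 = 0"
    and seminorm_minus: "p (- x) = p x"
    and seminorm_nonneg: "0 \<le> p x"
    and seminorm_diff: "p (x - y) \<le> p x + p y"
proof -
  show add: "p (x + y) \<le> p x + p y" for x y
    using assms unfolding seminorm_def by blast
  show scale: "p (smul c x) = norm c * p x" for c x
    using assms unfolding seminorm_def by blast
  show zero: "p 0 = 0" using scale[of 0 0] by simp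
  show minus: "p (- x) = p x" for x using scale[of "- 1" x] by simp
  show "0 \<le> p x" using add[of x "- x"] zero minus by simp
  show "p (x - y) \<le> p x + p y" using add[of x "- y"] minus by simp
qed

lemma seminormI:
  assumes add: "\<And>x y. p (x + y) \<le> p x + p y" and zero: "p 0 = 0"
    and scale: "\<And>c x. c \<noteq> 0 \<Longrightarrow> p (smul c x) \<le> norm c * p x"
  shows "seminorm smul p"
  unfolding seminorm_def
proof (intro conjI allI add)
  fix c x
  show "p (smul c x) = norm c * p x"
  proof (cases "c = 0")
    case False
    have "norm c * p (smul (1 / c) (smul c x)) \<le> norm c * (norm (1 / c) * p (smul c x))"
      using False by (intro mult_left_mono scale) auto
    then have "norm c * p x \<le> p (smul c x)"
      using False by (simp add: norm_divide)
    with scale[OF False, of x] show ?thesis by simp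
  qed (simp add: zero)
qed

lemma seminorm_sum:
  assumes "seminorm smul p"
  shows "p (\<Sum>i\<in>A. f i) \<le> (\<Sum>i\<in>A. p (f i))"
proof (induction A rule: infinite_finite_induct)
  case (insert i A)
  then show ?case using seminorm_add[OF assms, of "f i" "sum f A"] by simp
qed (simp_all add: seminorm_zero[OF assms])

lemma linearI:
  assumes "\<And>x y. f (x + y) = f x + f y" "\<And>c x. f (smul c x) = c * f x"
  shows "Vector_Spaces.linear smul (*) f"
  by (intro Vector_Spaces.linear_iff[THEN iffD2] conjI allI vector_space_axioms assms)
     (unfold_locales, simp_all add: algebra_simps)

lemma linearD:
  assumes "Vector_Spaces.linear smul (*) f"
  shows linear_plus: "f (x + y) = f x + f y"
    and linear_smul: "f (smul c x) = c * f x"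
    and linear_minus: "f (x - y) = f x - f y"
    and linear_sum: "f (sum g A) = (\<Sum>i\<in>A. f (g i))"
proof -
  interpret f: Vector_Spaces.linear smul "(*)" f by (rule assms)
  show "f (x + y) = f x + f y" "f (smul c x) = c * f x" "f (x - y) = f x - f y"
    "f (sum g A) = (\<Sum>i\<in>A. f (g i))"
    by (rule f.add f.scale f.diff f.sum)+
qed

text \<open>The real Hahn--Banach theorem norms \<open>p\<close> at \<open>y\<close> by a real
  functional, which is the real part of a complex one.\<close>

lemma norming_functional_exists:
  assumes p: "seminorm smul p"
  obtains g where "Vector_Spaces.linear smul (*) g" "\<And>x. norm (g x) \<le> p x" "norm (g y) = p y"
proof -
  interpret R: real_vector_space "\<lambda>t. smul (of_real t)" by (rule real_vector_space)
  have "sublinear (\<lambda>t. smul (of_real t)) p"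
    unfolding sublinear_def using seminorm_add[OF p] seminorm_scale[OF p] by auto
  from R.norming_linear_exists[OF this, of y] obtain f
    where f: "Vector_Spaces.linear (\<lambda>t. smul (of_real t)) (*) f" "f \<le> p" "f y = p y"
    by blast
  interpret f: Vector_Spaces.linear "\<lambda>t. smul (of_real t)" "(*)" f by (rule f(1))
  \<comment> \<open>The only complex linear functional with real part \<open>f\<close>, because
    \<open>Re (g (smul \<i> x)) = - Im (g x)\<close>.\<close>
  define g where "g x = Complex (f x) (- f (smul \<i> x))" for x
  have split: "smul c x = smul (of_real (Re c)) x + smul (of_real (Im c)) (smul \<i> x)" for c x
    by (simp flip: scale_left_distrib) (metis complex_eq mult.commute)
  have f_smul: "f (smul c x) = Re c * f x + Im c * f (smul \<i> x)" for c x
    unfolding split[of c x] f.add f.scale ..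
  have lin: "Vector_Spaces.linear smul (*) g"
  proof (rule linearI)
    show "g (x + z) = g x + g z" for x z
      by (simp add: g_def scale_right_distrib f.add complex_eq_iff)
    show "g (smul c x) = c * g x" for c x
    proof -
      have "f (smul \<i> (smul c x)) = - Im c * f x + Re c * f (smul \<i> x)"
        using f_smul[of "\<i> * c" x] by simp
      then show ?thesis
        by (simp add: g_def complex_eq_iff f_smul[of c x])
    qed
  qed
  have le: "norm (g x) \<le> p x" for x
  proof (cases "g x = 0")
    case False
    text \<open>Rotate \<open>x\<close> so that \<open>g\<close> takes a real value there, which is then a value of \<open>f\<close>.\<close>
    define c where "c = of_real (norm (g x)) / g x"
    have "c * g x = of_real (norm (g x))"
      using False by (simp add: c_def)
    then have "norm (g x) = Re (g (smul c x))"
      by (simp add: linear_smul[OF lin])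
    also have "\<dots> = f (smul c x)" by (simp add: g_def)
    also have "\<dots> \<le> p (smul c x)" by (rule le_funD[OF f(2)])
    also have "\<dots> = p x"
      using False by (simp add: seminorm_scale[OF p] c_def norm_divide)
    finally show ?thesis .
  qed (simp add: seminorm_nonneg[OF p])
  have "p y \<le> norm (g y)"
    using abs_Re_le_cmod[of "g y"] f(3) by (simp add: g_def)
  with le[of y] show ?thesis
    by (intro that[OF lin le]) simp
qed

text \<open>A single hump: if \<open>g\<close> norms \<open>p\<close> at \<open>y\<close>, the
  values of \<open>F + r * g\<close> and \<open>F - r * g\<close> at \<open>y\<close> are
  \<open>2 * r * p y\<close> apart, so one of them has modulus at least
  \<open>r * p y\<close>.\<close>

lemma perturbed_functional_exists:
  assumes p: "seminorm smul p" and F: "Vector_Spaces.linear smul (*) F" and r: "0 \<le> r"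
  shows "\<exists>G. Vector_Spaces.linear smul (*) G \<and> (\<forall>x. norm (G x - F x) \<le> r * p x) \<and>
    r * p y \<le> norm (G y)"
proof -
  obtain g where g: "Vector_Spaces.linear smul (*) g" "\<And>x. norm (g x) \<le> p x" "norm (g y) = p y"
    using norming_functional_exists[OF p] by blast
  have bound: "norm (r * g x) \<le> r * p x" for x
    using r g(2) by (simp add: norm_mult mult_left_mono)
  have lin: "Vector_Spaces.linear smul (*) (\<lambda>x. F x + r * g x)"
    "Vector_Spaces.linear smul (*) (\<lambda>x. F x - r * g x)"
    by (rule linearI; simp add: linear_plus[OF F] linear_smul[OF F] linear_plus[OF g(1)]
          linear_smul[OF g(1)] algebra_simps)+
  have "2 * (r * p y) = norm ((F y + r * g y) - (F y - r * g y))"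
    using r g(3) by (simp add: norm_mult)
  also have "\<dots> \<le> norm (F y + r * g y) + norm (F y - r * g y)"
    by (rule norm_triangle_ineq4)
  finally consider "r * p y \<le> norm (F y + r * g y)" | "r * p y \<le> norm (F y - r * g y)"
    by linarith
  then show ?thesis
  proof cases
    case 1
    then show ?thesis
      by (intro exI[of _ "\<lambda>x. F x + r * g x"] conjI lin) (simp_all add: bound)
  next
    case 2
    then show ?thesis
      by (intro exI[of _ "\<lambda>x. F x - r * g x"] conjI lin) (simp_all add: bound)
  qed
qed

text \<open>
  Gliding hump: if \<open>p\<close> is unbounded along \<open>x\<close>, then functionals \<open>F n\<close> are perturbed by amounts of
  size \<open>1 / 3 ^ Suc n\<close>, each time making the value at a suitable \<open>x (k n)\<close> so large that the later
  perturbations cannot destroy it.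
\<close>

lemma weakly_bounded_imp_seminorm_bounded:
  assumes p: "seminorm smul p"
    and weak: "\<And>g. Vector_Spaces.linear smul (*) g \<Longrightarrow> (\<And>y. norm (g y) \<le> p y) \<Longrightarrow>
      Bseq (\<lambda>n. g (x n))"
  shows "\<exists>M. \<forall>n::nat. p (x n) \<le> M"
proof (rule ccontr)
  assume "\<not> ?thesis"
  \<comment> \<open>The threshold fits the last estimate: of \<open>p (x (k n)) / 3 ^ Suc n\<close>
    at least half survives the later perturbations, and this half has to exceed
    \<open>n\<close>.\<close>
  then have "\<forall>n. \<exists>k. 6 * real n * 3 ^ n < p (x k)" by (meson not_le)
  then obtain k where k: "\<And>n. 6 * real n * 3 ^ n < p (x (k n))" by metis
  define lin where "lin F \<longleftrightarrow> Vector_Spaces.linear smul (*) F" for F :: "'b \<Rightarrow> complex"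
  \<comment> \<open>The clause for \<open>n = 0\<close> makes the recursion start at the zero
    functional, which later gives the bound of the limit by \<open>p\<close>.\<close>
  have "\<exists>F. \<forall>n. (lin (F n) \<and> (n = 0 \<longrightarrow> F n = (\<lambda>_. 0))) \<and>
      ((\<forall>y. norm (F (Suc n) y - F n y) \<le> 1 / 3 ^ Suc n * p y) \<and>
        1 / 3 ^ Suc n * p (x (k n)) \<le> norm (F (Suc n) (x (k n))))"
  proof (rule dependent_nat_choice)
    show "\<exists>F. lin F \<and> (0 = (0::nat) \<longrightarrow> F = (\<lambda>_. 0))"
      unfolding lin_def by (intro exI[of _ "\<lambda>_. 0"] conjI linearI) auto
    fix F n assume "lin F \<and> (n = (0::nat) \<longrightarrow> F = (\<lambda>_. 0))"
    then show "\<exists>G. (lin G \<and> (Suc n = 0 \<longrightarrow> G = (\<lambda>_. 0))) \<and>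
      ((\<forall>y. norm (G y - F y) \<le> 1 / 3 ^ Suc n * p y) \<and>
        1 / 3 ^ Suc n * p (x (k n)) \<le> norm (G (x (k n))))"
      using perturbed_functional_exists[OF p, of F "1 / 3 ^ Suc n" "x (k n)"]
      unfolding lin_def by auto
  qed
  then obtain F where F: "\<And>n. Vector_Spaces.linear smul (*) (F n)" "F 0 = (\<lambda>_. 0)"
      "\<And>n y. norm (F (Suc n) y - F n y) \<le> 1 / 3 ^ Suc n * p y"
      "\<And>n. 1 / 3 ^ Suc n * p (x (k n)) \<le> norm (F (Suc n) (x (k n)))"
    unfolding lin_def by blast
  \<comment> \<open>The factor is the geometric sum of \<open>1 / 3 ^ Suc j\<close> over
    \<open>n \<le> j < m\<close>.\<close>
  have tail: "norm (F m y - F n y) \<le> (1 / 3 ^ n - 1 / 3 ^ m) / 2 * p y" if "n \<le> m" for m n y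
    using that
  proof (induction m rule: dec_induct)
    case (step m)
    have "norm (F (Suc m) y - F n y) \<le> norm (F (Suc m) y - F m y) + norm (F m y - F n y)"
      using norm_triangle_ineq[of "F (Suc m) y - F m y" "F m y - F n y"] by simp
    also have "\<dots> \<le> 1 / 3 ^ Suc m * p y + (1 / 3 ^ n - 1 / 3 ^ m) / 2 * p y"
      by (intro add_mono F step.IH)
    finally show ?case by (simp add: field_simps)
  qed simp
  have tail': "norm (F m y - F n y) \<le> 1 / 3 ^ n / 2 * p y" if "n \<le> m" for m n y
    by (rule order_trans[OF tail[OF that]]) (intro mult_right_mono seminorm_nonneg[OF p]; simp)
  have "Cauchy (\<lambda>n. F n y)" for y
  proof (rule CauchyI')
    fix e :: real assume "0 < e"
    have "(\<lambda>n. (1 / 3) ^ n / 2 * p y) \<longlonglongrightarrow> 0 / 2 * p y"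
      by (intro tendsto_intros) auto
    then have "\<forall>\<^sub>F n in sequentially. (1 / 3) ^ n / 2 * p y < e"
      by (rule order_tendstoD) (simp add: \<open>0 < e\<close>)
    then obtain N where "\<And>n. N \<le> n \<Longrightarrow> (1 / 3) ^ n / 2 * p y < e"
      unfolding eventually_sequentially by blast
    then have "dist (F m y) (F n y) < e" if "N \<le> m" "m < n" for m n
      using tail'[of m n y] that by (fastforce simp: power_one_over dist_norm norm_minus_commute)
    then show "\<exists>N. \<forall>m\<ge>N. \<forall>n>m. dist (F m y) (F n y) < e"
      by blast
  qed
  then have "\<forall>y. \<exists>l. (\<lambda>n. F n y) \<longlonglongrightarrow> l"
    using Cauchy_convergent convergent_def by blast
  then obtain f where f: "\<And>y. (\<lambda>n. F n y) \<longlonglongrightarrow> f y" by metis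
  have lin: "Vector_Spaces.linear smul (*) f"
  proof (rule linearI)
    fix y z c
    show "f (y + z) = f y + f z"
      using f[of "y + z"] tendsto_add[OF f[of y] f[of z]]
      by (simp add: linear_plus[OF F(1)] LIMSEQ_unique)
    show "f (smul c y) = c * f y"
      using f[of "smul c y"] tendsto_mult_left[OF f[of y], of c]
      by (simp add: linear_smul[OF F(1)] LIMSEQ_unique)
  qed
  have close: "norm (f y - F n y) \<le> 1 / 3 ^ n / 2 * p y" for y n
    by (rule LIMSEQ_le_const2[OF tendsto_norm[OF tendsto_diff[OF f tendsto_const]]])
       (use tail' in blast)
  \<comment> \<open>The case \<open>n = 0\<close> of \<open>close\<close> bounds the limit even by
    \<open>p y / 2\<close>, so the weak hypothesis applies to \<open>f\<close>.\<close>
  have "norm (f y) \<le> p y" for y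
    using close[of y 0] F(2) seminorm_nonneg[OF p, of y] by simp
  from weak[OF lin this] obtain M where M: "\<And>n. norm (f (x n)) \<le> M"
    unfolding Bseq_def by blast
  have "real n < M" for n
  proof -
    have "1 / 3 ^ Suc n * p (x (k n)) \<le> norm (F (Suc n) (x (k n)))" by (rule F(4))
    also have "\<dots> \<le> norm (f (x (k n))) + norm (f (x (k n)) - F (Suc n) (x (k n)))"
      using norm_triangle_ineq4[of "f (x (k n))" "f (x (k n)) - F (Suc n) (x (k n))"] by simp
    also have "\<dots> \<le> M + 1 / 3 ^ Suc n / 2 * p (x (k n))"
      by (intro add_mono M close)
    finally have "p (x (k n)) \<le> 6 * M * 3 ^ n" by (simp add: field_simps)
    from less_le_trans[OF k this] show ?thesis by simp
  qed
  then show False using reals_Archimedean2[of M] by (meson less_asym)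
qed

end

section \<open>Gauges and continuous functionals\<close>

context locally_convex_space
begin

sublocale complex_vector_space smul ..

lemma continuous_smul: "continuous_on UNIV (smul c)"
  using continuous_on_compose2[OF continuous_scale, of UNIV "\<lambda>x. (c, x)"]
  by (simp add: continuous_on_Pair continuous_on_const continuous_on_id)

lemma continuous_smul_left: "continuous_on UNIV (\<lambda>c. smul c x)"
  using continuous_on_compose2[OF continuous_scale, of UNIV "\<lambda>c. (c, x)"]
  by (simp add: continuous_on_Pair continuous_on_const continuous_on_id)

text \<open>Continuity of \<open>c \<mapsto> smul c x\<close> at \<open>0\<close>; the factor is
  written \<open>1 / t\<close> to match the gauge below.\<close>

lemma absorbing:
  assumes "open W" "0 \<in> W"
  obtains t where "0 < t" "smul (of_real (1 / t)) x \<in> W"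
proof -
  have "open ((\<lambda>c. smul c x) -` W)"
    by (rule open_vimage[OF \<open>open W\<close> continuous_smul_left])
  moreover have "0 \<in> (\<lambda>c. smul c x) -` W" using \<open>0 \<in> W\<close> by simp
  ultimately obtain e where e: "0 < e" "cball 0 e \<subseteq> (\<lambda>c. smul c x) -` W"
    using open_contains_cball by blast
  have "complex_of_real e \<in> cball 0 e" using e(1) by simp
  then have "smul (of_real e) x \<in> W" using e(2) by blast
  with e(1) show ?thesis by (intro that[of "1 / e"]) auto
qed

text \<open>\<open>B\<close> is the balanced core of a convex neighbourhood \<open>V\<close>: it
  inherits convexity, and joint continuity of scaling at \<open>(0, 0)\<close> keeps it a
  neighbourhood of \<open>0\<close>.\<close>

lemma balanced_convex_neighbourhood:
  assumes "open U" "0 \<in> U"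
  obtains B W where "open W" "0 \<in> W" "W \<subseteq> B" "B \<subseteq> U"
    "\<And>c x. x \<in> B \<Longrightarrow> norm c \<le> 1 \<Longrightarrow> smul c x \<in> B"
    "\<And>x y t. x \<in> B \<Longrightarrow> y \<in> B \<Longrightarrow> t \<in> {0..1} \<Longrightarrow>
      smul (of_real (1 - t)) x + smul (of_real t) y \<in> B"
proof -
  obtain V W where V: "open W" "0 \<in> W" "W \<subseteq> V" "V \<subseteq> U"
    "\<And>x y t. x \<in> V \<Longrightarrow> y \<in> V \<Longrightarrow> t \<in> {0..1::real} \<Longrightarrow>
      smul (of_real (1 - t)) x + smul (of_real t) y \<in> V"
    using locally_convex[OF assms] by metis
  define B where "B = {x. \<forall>c. norm c \<le> 1 \<longrightarrow> smul c x \<in> V}"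
  have "open ((\<lambda>(c, x). smul c x) -` W)"
    by (rule open_vimage[OF V(1) continuous_scale])
  moreover have "(0, 0) \<in> (\<lambda>(c, x). smul c x) -` W" using V(2) by simp
  ultimately obtain C X where CX: "open C" "open X" "0 \<in> C" "0 \<in> X"
      "C \<times> X \<subseteq> (\<lambda>(c, x). smul c x) -` W"
    by (rule open_prod_elim) auto
  obtain d where d: "0 < d" "cball 0 d \<subseteq> C"
    using CX(1,3) open_contains_cball by blast
  \<comment> \<open>Chosen so that \<open>smul c x\<close> with \<open>norm c \<le> 1\<close> is
    \<open>c * d\<close> acting on a point of \<open>X\<close>, where \<open>c * d\<close> lies in
    \<open>C\<close>.\<close>
  define Y where "Y = smul (of_real (1 / d)) -` X"
  have "Y \<subseteq> B"
  proof
    fix x assume x: "x \<in> Y"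
    have "smul c x \<in> V" if "norm c \<le> 1" for c
    proof -
      have "c * of_real d \<in> C"
        using d that by (intro subsetD[OF d(2)]) (simp add: norm_mult)
      with x have "(c * of_real d, smul (of_real (1 / d)) x) \<in> C \<times> X" by (simp add: Y_def)
      then have "smul (c * of_real d) (smul (of_real (1 / d)) x) \<in> W"
        using subsetD[OF CX(5)] by fastforce
      moreover have "c * of_real d * of_real (1 / d) = c" using d(1) by simp
      ultimately show ?thesis using V(3) by (simp only: scale_scale) blast
    qed
    then show "x \<in> B" by (simp add: B_def)
  qed
  have "open Y"
    unfolding Y_def by (rule open_vimage[OF CX(2) continuous_smul])
  have "0 \<in> Y" using CX(4) by (simp add: Y_def)
  have "B \<subseteq> U"
  proof
    fix x assume "x \<in> B"
    then have "smul 1 x \<in> V" unfolding B_def by (simp del: scale_one)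
    then show "x \<in> U" using V(4) by auto
  qed
  have balanced: "smul c x \<in> B" if "x \<in> B" "norm c \<le> 1" for c x
    using that by (auto simp: B_def norm_mult mult_le_one)
  have conv: "smul (of_real (1 - t)) x + smul (of_real t) y \<in> B"
    if "x \<in> B" "y \<in> B" "t \<in> {0..1}" for x y and t :: real
    unfolding B_def
  proof (intro CollectI allI impI)
    fix c :: complex assume "norm c \<le> 1"
    then have "smul (of_real (1 - t)) (smul c x) + smul (of_real t) (smul c y) \<in> V"
      using that by (intro V(5)) (auto simp: B_def)
    then show "smul c (smul (of_real (1 - t)) x + smul (of_real t) y) \<in> V"
      by (simp add: scale_right_distrib mult.commute)
  qed
  show ?thesis
    by (rule that[OF \<open>open Y\<close> \<open>0 \<in> Y\<close> \<open>Y \<subseteq> B\<close> \<open>B \<subseteq> U\<close> balanced conv])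
qed

text \<open>The seminorm is the Minkowski gauge of a balanced convex neighbourhood. The set
  \<open>W\<close> serves to make functionals dominated by \<open>p\<close> continuous.\<close>

lemma neighbourhood_contains_seminorm_ball:
  assumes "open U" "0 \<in> U"
  obtains p W where "seminorm smul p" "\<And>x. p x < 1 \<Longrightarrow> x \<in> U"
    "open W" "0 \<in> W" "\<And>x. x \<in> W \<Longrightarrow> p x \<le> 1"
proof -
  obtain B W where W: "open W" "0 \<in> W" "W \<subseteq> B" "B \<subseteq> U"
    and balanced: "\<And>c x. x \<in> B \<Longrightarrow> norm c \<le> 1 \<Longrightarrow> smul c x \<in> B"
    and conv: "\<And>x y t. x \<in> B \<Longrightarrow> y \<in> B \<Longrightarrow> t \<in> {0..1} \<Longrightarrow>
      smul (of_real (1 - t)) x + smul (of_real t) y \<in> B"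
    by (rule balanced_convex_neighbourhood[OF assms]) (rule that)
  define T where "T x = {t::real. 0 < t \<and> smul (of_real (1 / t)) x \<in> B}" for x
  define p where "p x = Inf (T x)" for x
  have T_nonempty: "T x \<noteq> {}" for x
    using absorbing[OF W(1,2), of x] W(3) by (auto simp: T_def)
  have lower: "p x \<le> t" if "t \<in> T x" for t x
    unfolding p_def using that by (intro cInf_lower bdd_belowI[of _ 0]) (auto simp: T_def)
  have greatest: "m \<le> p x" if "\<And>t. t \<in> T x \<Longrightarrow> m \<le> t" for m x
    unfolding p_def using T_nonempty that by (rule cInf_greatest)
  \<comment> \<open>The point \<open>x + y\<close> scaled by \<open>1 / (s + t)\<close> is the
    convex combination of the scaled \<open>x\<close> and \<open>y\<close> with weight
    \<open>t / (s + t)\<close> on the latter.\<close>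
  have add: "s + t \<in> T (x + y)" if s: "s \<in> T x" and t: "t \<in> T y" for s t x y
  proof -
    have pos: "0 < s" "0 < t" using s t by (auto simp: T_def)
    have "smul (of_real (1 - t / (s + t))) (smul (of_real (1 / s)) x) +
        smul (of_real (t / (s + t))) (smul (of_real (1 / t)) y) \<in> B"
      using s t pos by (intro conv) (auto simp: T_def)
    moreover have "(1 - t / (s + t)) * (1 / s) = 1 / (s + t)" "t / (s + t) * (1 / t) = 1 / (s + t)"
      using pos by (simp_all add: field_simps)
    ultimately have "smul (of_real (1 / (s + t))) x + smul (of_real (1 / (s + t))) y \<in> B"
      by (simp only: scale_scale of_real_mult[symmetric])
    with pos show ?thesis by (simp add: T_def scale_right_distrib)
  qed
  have "seminorm smul p"
  proof (rule seminormI)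
    fix x y
    have "p (x + y) - p x \<le> p y"
    proof (rule greatest)
      fix t assume t: "t \<in> T y"
      have "p (x + y) - t \<le> p x"
      proof (rule greatest)
        fix s assume "s \<in> T x"
        from lower[OF add[OF this t]] show "p (x + y) - t \<le> s" by simp
      qed
      then show "p (x + y) - p x \<le> t" by simp
    qed
    then show "p (x + y) \<le> p x + p y" by simp
  next
    have "T 0 = {0<..}" using W(2,3) by (auto simp: T_def)
    then show "p 0 = 0" by (simp add: p_def)
  next
    fix c x assume c: "c \<noteq> (0::complex)"
    have "p (smul c x) / norm c \<le> p x"
    proof (rule greatest)
      fix t assume t: "t \<in> T x"
      \<comment> \<open>Dividing by the modulus leaves a scalar of norm one, to which balancedness
        applies.\<close>
      have "smul (c / of_real (norm c)) (smul (of_real (1 / t)) x) \<in> B"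
        using t c by - (rule balanced; simp add: T_def norm_divide)
      then have "norm c * t \<in> T (smul c x)"
        using t c by (simp add: T_def mult.commute)
      from lower[OF this] show "p (smul c x) / norm c \<le> t"
        using c by (simp add: field_simps)
    qed
    then show "p (smul c x) \<le> norm c * p x"
      using c by (simp add: field_simps)
  qed
  moreover have "x \<in> U" if less: "p x < 1" for x
  proof -
    obtain t where t: "t \<in> T x" "t < 1"
      using greatest[of x 1] less by (meson not_le)
    then have "smul (of_real t) (smul (of_real (1 / t)) x) \<in> B"
      by - (rule balanced; simp add: T_def)
    with t(1) W(4) show ?thesis by (auto simp: T_def simp flip: of_real_mult)
  qed
  moreover have "p x \<le> 1" if "x \<in> W" for x
    using that W(3) by (intro lower) (auto simp: T_def)
  ultimately show ?thesis
    by (rule that[OF _ _ W(1,2)])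
qed

text \<open>By linearity, boundedness near \<open>0\<close> is translated and scaled to continuity
  everywhere.\<close>

lemma dominated_functional_in_dual:
  assumes g: "Vector_Spaces.linear smul (*) g"
    and W: "open W" "0 \<in> W" and bound: "\<And>x. x \<in> W \<Longrightarrow> norm (g x) \<le> 1"
  shows "g \<in> topological_dual smul"
proof -
  have "isCont g x" for x
    unfolding isCont_def
  proof (rule tendstoI)
    fix e :: real assume e: "0 < e"
    \<comment> \<open>The factor \<open>2 / e\<close> yields the bound \<open>e / 2\<close>, hence a
      strict inequality from the weak one on \<open>W\<close>.\<close>
    have "continuous_on UNIV (\<lambda>z. smul (of_real (2 / e)) (z - x))"
      by (rule continuous_on_compose2[OF continuous_smul]) (auto intro!: continuous_intros)
    then have "open ((\<lambda>z. smul (of_real (2 / e)) (z - x)) -` W)"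
      by (rule open_vimage[OF W(1)])
    moreover have "x \<in> (\<lambda>z. smul (of_real (2 / e)) (z - x)) -` W"
      using W(2) by simp
    moreover have "dist (g z) (g x) < e" if "smul (of_real (2 / e)) (z - x) \<in> W" for z
    proof -
      have "2 / e * norm (g z - g x) \<le> 1"
        using bound[OF that] e
        by (simp only: linear_smul[OF g] linear_minus[OF g] norm_mult norm_of_real) simp
      with e have "2 * norm (g z - g x) \<le> e" by (simp add: field_simps)
      with e show ?thesis unfolding dist_norm by linarith
    qed
    ultimately show "\<forall>\<^sub>F z in at x. dist (g z) (g x) < e"
      unfolding eventually_at_topological by blast
  qed
  with g show ?thesis
    by (simp add: topological_dual_def continuous_on_eq_continuous_at)
qed

end

section \<open>Dirichlet's test\<close>

text \<open>The boundary term carries \<open>c n\<close>, one index beyond the sum, so that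
  \<open>n = 0\<close> is covered and the induction step is mere rearrangement.\<close>

lemma summation_by_parts:
  fixes smul :: "complex \<Rightarrow> 'b::ab_group_add \<Rightarrow> 'b"
  assumes "vector_space smul"
  shows "(\<Sum>k<n. smul (c k) (b k)) =
    smul (c n) (\<Sum>k<n. b k) - (\<Sum>k<n. smul (c (Suc k) - c k) (\<Sum>j<Suc k. b j))"
proof -
  interpret vector_space smul by (rule assms)
  show ?thesis
    by (induction n) (simp_all add: scale_right_distrib scale_left_diff_distrib algebra_simps)
qed

context sequentially_complete_lcs
begin

text \<open>If \<open>p\<close> is at most \<open>M\<close> on the partial sums of \<open>b\<close>,
  summation by parts bounds a block of the series by \<open>M\<close> times the two end values of
  \<open>norm (c n)\<close> plus the variation of \<open>c\<close> between them.\<close>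

lemma dirichlet_test:
  assumes c: "c \<longlonglongrightarrow> 0" and var: "summable (\<lambda>n. norm (c (Suc n) - c n))"
    and weak: "\<And>g. g \<in> topological_dual smul \<Longrightarrow> Bseq (\<lambda>n. g (\<Sum>k<n. b k))"
  shows "summable (\<lambda>n. smul (c n) (b n))"
proof -
  define S where "S n = (\<Sum>k<n. b k)" for n
  define T where "T n = (\<Sum>k<n. smul (c k) (b k))" for n
  define v where "v n = (\<Sum>k<n. norm (c (Suc k) - c k))" for n
  have "Cauchy T"
    unfolding Cauchy_iff_diff_in_neighbourhoods
  proof (intro allI impI)
    fix U :: "'a set" assume "open U" "0 \<in> U"
    then obtain p W where p: "seminorm smul p" and U: "\<And>x. p x < 1 \<Longrightarrow> x \<in> U"
      and W: "open W" "0 \<in> W" "\<And>x. x \<in> W \<Longrightarrow> p x \<le> 1"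
      by (rule neighbourhood_contains_seminorm_ball) (rule that)
    \<comment> \<open>A functional dominated by \<open>p\<close> is at most \<open>1\<close> on
      \<open>W\<close>, hence continuous, so \<open>weak\<close> applies to it.\<close>
    have "\<exists>M. \<forall>n. p (S n) \<le> M"
      unfolding S_def
      by (intro weakly_bounded_imp_seminorm_bounded p weak
          dominated_functional_in_dual[OF _ W(1,2)])
         (auto intro: order_trans W(3))
    then obtain M0 where "\<And>n. p (S n) \<le> M0" by blast
    \<comment> \<open>A positive bound is needed to divide by it below.\<close>
    then have "0 < max M0 1" "\<And>n. p (S n) \<le> max M0 1" by (auto simp: le_max_iff_disj)
    then obtain M where M: "0 < M" "\<And>n. p (S n) \<le> M" by blast
    have T_diff: "p (T n - T m) \<le> M * (norm (c n) + norm (c m) + norm (v n - v m))"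
      if "m \<le> n" for m n
    proof -
      have split: "(\<Sum>k<n. f k) - (\<Sum>k<m. f k) = (\<Sum>k\<in>{m..<n}. f k)"
        for f :: "nat \<Rightarrow> 'c::ab_group_add"
        using sum_diff_nat_ivl[of 0 m n f] that by (simp add: lessThan_atLeast0)
      define D where "D = (\<Sum>k\<in>{m..<n}. smul (c (Suc k) - c k) (S (Suc k)))"
      have T: "T n = smul (c n) (S n) - (\<Sum>k<n. smul (c (Suc k) - c k) (S (Suc k)))" for n
        unfolding T_def S_def by (rule summation_by_parts[OF vector_space_axioms])
      have "T n - T m = smul (c n) (S n) - smul (c m) (S m) - D"
        unfolding T D_def split[symmetric] by (simp add: algebra_simps)
      then have "p (T n - T m) \<le> p (smul (c n) (S n)) + p (smul (c m) (S m)) + p D"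
        using seminorm_diff[OF p, of "smul (c n) (S n) - smul (c m) (S m)" D]
          seminorm_diff[OF p, of "smul (c n) (S n)" "smul (c m) (S m)"] by simp
      also have "p D \<le> (\<Sum>k\<in>{m..<n}. norm (c (Suc k) - c k) * p (S (Suc k)))"
        unfolding D_def seminorm_scale[OF p, symmetric] by (rule seminorm_sum[OF p])
      also have "\<dots> \<le> (\<Sum>k\<in>{m..<n}. norm (c (Suc k) - c k) * M)"
        by (intro sum_mono mult_left_mono M(2)) simp
      also have "\<dots> = (v n - v m) * M"
        unfolding v_def split sum_distrib_right ..
      also have "\<dots> \<le> norm (v n - v m) * M"
        using M(1) by (intro mult_right_mono) auto
      also have "p (smul (c n) (S n)) \<le> norm (c n) * M"
        unfolding seminorm_scale[OF p] by (intro mult_left_mono M(2)) simp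
      also have "p (smul (c m) (S m)) \<le> norm (c m) * M"
        unfolding seminorm_scale[OF p] by (intro mult_left_mono M(2)) simp
      finally show ?thesis by (simp add: algebra_simps)
    qed
    have T_diff': "p (T n - T m) \<le> M * (norm (c n) + norm (c m) + norm (v n - v m))" for m n
    proof (cases "m \<le> n")
      case False
      then show ?thesis
        using T_diff[of n m] seminorm_minus[OF p, of "T m - T n"]
        by (simp add: add.commute abs_minus_commute)
    qed (rule T_diff)
    obtain N1 where N1: "\<And>n. N1 \<le> n \<Longrightarrow> norm (c n) < 1 / (3 * M)"
      using LIMSEQ_D[OF c, of "1 / (3 * M)"] M(1) by auto
    have "convergent v"
      using var unfolding v_def summable_iff_convergent .
    then obtain N2 where N2: "\<And>m n. N2 \<le> m \<Longrightarrow> N2 \<le> n \<Longrightarrow> norm (v m - v n) < 1 / (3 * M)"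
      using CauchyD[OF convergent_Cauchy, of v "1 / (3 * M)"] M(1) by auto
    have "T n - T m \<in> U" if "max N1 N2 \<le> n" "max N1 N2 \<le> m" for m n
    proof (rule U)
      have "norm (c n) + norm (c m) + norm (v n - v m) < 1 / M"
        using N1[of n] N1[of m] N2[of n m] that by (simp add: field_simps)
      then have "M * (norm (c n) + norm (c m) + norm (v n - v m)) < 1"
        using M(1) by (simp add: field_simps)
      with T_diff'[of n m] show "p (T n - T m) < 1" by simp
    qed
    then show "\<exists>N. \<forall>n\<ge>N. \<forall>m\<ge>N. T n - T m \<in> U" by blast
  qed
  then show ?thesis
    unfolding summable_iff_convergent T_def[symmetric] by (rule sequentially_complete)
qed

end

section \<open>Decay and bounded variation of the Dirichlet factors\<close>

lemma of_nat_powr_tendsto_0: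
  assumes "0 < Re w"
  shows "(\<lambda>n. 1 / of_nat (Suc n) powr w :: complex) \<longlonglongrightarrow> 0"
proof (rule tendsto_norm_zero_cancel)
  have "(\<lambda>n. real (Suc n) powr - Re w) \<longlonglongrightarrow> 0"
    using assms by (intro tendsto_neg_powr filterlim_compose[OF filterlim_real_sequentially]
        filterlim_Suc) auto
  moreover have "norm (1 / of_nat (Suc n) powr w :: complex) = real (Suc n) powr - Re w" for n
    using norm_powr_real_powr[of "of_nat (Suc n)" w]
    by (simp add: norm_divide powr_minus_divide)
  ultimately show "(\<lambda>n. norm (1 / of_nat (Suc n) powr w :: complex)) \<longlonglongrightarrow> 0"
    by simp
qed

text \<open>By the mean value inequality each difference is at most \<open>norm w\<close> times
  \<open>real (Suc n) powr (- Re w - 1)\<close>, which is summable because \<open>Re w\<close> is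
  positive.\<close>

lemma of_nat_powr_bounded_variation:
  assumes w: "0 < Re w"
  shows "summable (\<lambda>n. norm (1 / of_nat (Suc (Suc n)) powr w - 1 / of_nat (Suc n) powr w :: complex))"
proof (rule summable_comparison_test')
  have "summable (\<lambda>n. real n powr (- Re w - 1))"
    using w by (simp add: summable_real_powr_iff)
  then have "summable (\<lambda>n. real (Suc n) powr (- Re w - 1))"
    by (subst summable_Suc_iff)
  then show "summable (\<lambda>n. norm w * real (Suc n) powr (- Re w - 1))"
    by (rule summable_mult)
  fix n :: nat
  \<comment> \<open>A segment of the positive real axis inside the complex plane, away from the
    branch cut of \<open>powr\<close>.\<close>
  let ?S = "complex_of_real ` {real (Suc n)..real (Suc (Suc n))}"
  have "norm (of_nat (Suc (Suc n)) powr - w - of_nat (Suc n) powr - w :: complex)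
      \<le> norm w * real (Suc n) powr (- Re w - 1) * norm (of_nat (Suc (Suc n)) - of_nat (Suc n) :: complex)"
  proof (rule field_differentiable_bound[where S = ?S])
    show "convex ?S"
      by (intro convex_linear_image) (auto simp: bounded_linear.linear[OF bounded_linear_of_real])
    show "((\<lambda>z. z powr - w) has_field_derivative - w * z powr (- w - 1)) (at z within ?S)"
      if "z \<in> ?S" for z
      using that by (intro has_field_derivative_at_within[OF has_field_derivative_powr])
        (auto simp: complex_nonpos_Reals_iff)
    show "norm (- w * z powr (- w - 1)) \<le> norm w * real (Suc n) powr (- Re w - 1)"
      if "z \<in> ?S" for z
    proof -
      obtain t where t: "z = of_real t" "real (Suc n) \<le> t"
        using \<open>z \<in> ?S\<close> by (elim imageE) (simp only: atLeastAtMost_iff)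
      have "norm (z powr (- w - 1)) = t powr (- Re w - 1)"
        using t by (subst norm_powr_real_powr) auto
      also have "\<dots> \<le> real (Suc n) powr (- Re w - 1)"
        using t w by (intro powr_mono2') auto
      finally show ?thesis by (simp add: norm_mult mult_left_mono)
    qed
    show "of_nat (Suc (Suc n)) \<in> ?S"
      by (rule image_eqI[where x = "real (Suc (Suc n))"]) simp_all
    show "of_nat (Suc n) \<in> ?S"
      by (rule image_eqI[where x = "real (Suc n)"]) simp_all
  qed
  then show "norm (norm (1 / of_nat (Suc (Suc n)) powr w - 1 / of_nat (Suc n) powr w :: complex))
      \<le> norm w * real (Suc n) powr (- Re w - 1)"
    by (simp add: powr_minus_divide)
qed

section \<open>Weak and strong convergence of Dirichlet series\<close>

context sequentially_complete_lcs
begin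

lemma dirichlet_converges_if_weakly:
  assumes weak: "\<And>g. g \<in> topological_dual smul \<Longrightarrow> dirichlet_converges (*) (\<lambda>n. g (a n)) s0"
    and s: "Re s0 < Re s"
  shows "dirichlet_converges smul a s"
proof -
  define b where "b n = smul (1 / of_nat (Suc n) powr s0) (a (Suc n))" for n
  have "Bseq (\<lambda>n. g (\<Sum>k<n. b k))" if g: "g \<in> topological_dual smul" for g
  proof -
    have lin: "Vector_Spaces.linear smul (*) g" using g by (simp add: topological_dual_def)
    show ?thesis
      using weak[OF g] unfolding dirichlet_converges_def summable_iff_convergent b_def
      by (simp add: linear_sum[OF lin] linear_smul[OF lin] convergent_imp_Bseq)
  qed
  \<comment> \<open>The exponents \<open>s - s0\<close> and \<open>s0\<close> add up to
    \<open>s\<close>, so these are the terms of the original series.\<close>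
  then have "summable (\<lambda>n. smul (1 / of_nat (Suc n) powr (s - s0)) (b n))"
    using s by (intro dirichlet_test of_nat_powr_tendsto_0 of_nat_powr_bounded_variation) auto
  then show ?thesis
    unfolding dirichlet_converges_def b_def scale_scale
    by (simp add: powr_diff del: of_nat_Suc)
qed

text \<open>The easy direction: continuity and linearity carry the limit of the partial sums over to
  the scalar series.\<close>

lemma weakly_dirichlet_converges:
  assumes g: "g \<in> topological_dual smul" and "dirichlet_converges smul a s"
  shows "dirichlet_converges (*) (\<lambda>n. g (a n)) s"
proof -
  have lin: "Vector_Spaces.linear smul (*) g" and cont: "continuous_on UNIV g"
    using g by (auto simp: topological_dual_def)
  obtain l where "(\<lambda>n. \<Sum>k<n. smul (1 / of_nat (Suc k) powr s) (a (Suc k))) \<longlonglongrightarrow> l"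
    using assms(2) unfolding dirichlet_converges_def summable_def sums_def by blast
  from continuous_on_tendsto_compose[OF cont this]
  show ?thesis
    unfolding dirichlet_converges_def summable_def sums_def
    by (auto simp: linear_sum[OF lin] linear_smul[OF lin])
qed

lemma weak_abscissa_conv_eq: "weak_abscissa_conv smul a = abscissa_conv smul a"
proof (rule antisym)
  show "weak_abscissa_conv smul a \<le> abscissa_conv smul a"
    unfolding weak_abscissa_conv_def
  proof (rule SUP_least)
    fix g assume "g \<in> topological_dual smul"
    then show "abscissa_conv (*) (\<lambda>n. g (a n)) \<le> abscissa_conv smul a"
      unfolding abscissa_conv_def by (intro Inf_superset_mono) (auto intro: weakly_dirichlet_converges)
  qed
  show "abscissa_conv smul a \<le> weak_abscissa_conv smul a"
  \<comment> \<open>Comparing real upper bounds covers infinite abscissas as well.\<close>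
  proof (rule ereal_le_real)
    fix r :: real assume r: "weak_abscissa_conv smul a \<le> ereal r"
    have conv: "dirichlet_converges smul a s" if s: "r < Re s" for s
    proof -
      \<comment> \<open>The point \<open>r'\<close> serves all functionals at once: it lies strictly
        right of \<open>r\<close>, where every scalar series converges, and strictly left of
        \<open>s\<close>, as the weak-to-strong step demands.\<close>
      obtain r' where r': "r < r'" "r' < Re s" using dense[OF s] by blast
      have "dirichlet_converges (*) (\<lambda>n. g (a n)) (of_real r')"
        if g: "g \<in> topological_dual smul" for g
      proof -
        have "abscissa_conv (*) (\<lambda>n. g (a n)) \<le> ereal r"
          using r g unfolding weak_abscissa_conv_def by (simp add: SUP_le_iff)
        then have "abscissa_conv (*) (\<lambda>n. g (a n)) < ereal r'"
          using r'(1) by (simp add: le_less_trans)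
        then show ?thesis
          unfolding abscissa_conv_def Inf_less_iff by auto
      qed
      then show ?thesis
        using r'(2) by (intro dirichlet_converges_if_weakly[of a "of_real r'"]) auto
    qed
    then show "abscissa_conv smul a \<le> ereal r"
      unfolding abscissa_conv_def by (intro Inf_lower) auto
  qed
qed

end

theorem proposition2p1:
  fixes smul :: "complex \<Rightarrow>
      'a::{uniform_topological_group_add,topological_ab_group_add,t2_space} \<Rightarrow> 'a"
    and a :: "nat \<Rightarrow> 'a"
  assumes "sequentially_complete_lcs smul"
  shows "(\<forall>s0. (\<forall>x'\<in>topological_dual smul. dirichlet_converges (*) (\<lambda>n. x' (a n)) s0) \<longrightarrow>
            (\<forall>s. Re s > Re s0 \<longrightarrow> dirichlet_converges smul a s)) \<and>
         weak_abscissa_conv smul a = abscissa_conv smul a"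
proof -
  interpret sequentially_complete_lcs smul by (rule assms)
  show ?thesis
    using dirichlet_converges_if_weakly weak_abscissa_conv_eq by blast
qed

end
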